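(* For each $n>0$ and all proper $\alpha_1,\dots,\alpha_{n+1},\alpha'_1,\dots,\alpha'_n\in2^\omega$ we have \[ s^{\oplus_{n+1}}_{\alpha_1,\dots,\alpha_{n+1}}\not\le_W s_{\alpha'_1}\times\dots\times s_{\alpha'_n}. \]
   Context: Cantor space $2^\omega$ carries the lexicographic order $<_{lex}$. For $\alpha\in2^\omega$, $s_\alpha\colon 2^\omega\to\{0,1\}$ is $s_\alpha(x)=0$ if $x<_{lex}\alpha$ and $s_\alpha(x)=1$ if $x\ge_{lex}\alpha$. A sequence is proper if it contains infinitely many $1$'s. $s^{\oplus_{m}}_{\alpha_1,\dots,\alpha_m}\colon(2^\omega)^m\to\{0,1\}$ is $(x_1,\dots,x_m)\mapsto s_{\alpha_1}(x_1)\oplus\dots\oplus s_{\alpha_m}(x_m)$ ($\oplus$ = addition modulo 2). The product $f_1\times\dots\times f_n$ maps $(x_1,\dots,x_n)$ to $(f_1(x_1),\dots,f_n(x_n))$. $f\le_W g$ means there are computable functionals $\Phi,\Psi$ with $f(x)=\Psi(x,g(\Phi(x)))$ for all $x$ in the domain of $f$. *)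

theory Defs
  imports
    "HOL-Library.Fun_Lexorder"
    "HOL-Library.Nat_Bijection"
    "HOL-Library.Z2"
begin

section \<open>Computation relative to an oracle\<close>

text \<open>
  Kleene's partial recursive functions of several numbers relative to an oracle
  \<open>p :: nat \<Rightarrow> nat\<close>. Superfluous arguments are ignored by \<open>Zero\<close>, \<open>Succ\<close> and \<open>Query\<close>.
\<close>

datatype oprog =
    Zero
  | Succ
  | Proj nat
  | Query
  | Comp oprog "oprog list"
  | PRec oprog oprog
  | Mu oprog

inductive oeval :: "(nat \<Rightarrow> nat) \<Rightarrow> oprog \<Rightarrow> nat list \<Rightarrow> nat \<Rightarrow> bool" for p where
  Zero: "oeval p Zero ns 0"
| Succ: "oeval p Succ (n # ns) (Suc n)"
| Proj: "i < length ns \<Longrightarrow> oeval p (Proj i) ns (ns ! i)"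
| Query: "oeval p Query (n # ns) (p n)"
| Comp: "list_all2 (\<lambda>g m. oeval p g ns m) gs ms \<Longrightarrow> oeval p f ms r \<Longrightarrow> oeval p (Comp f gs) ns r"
| PRec_0: "oeval p f ns r \<Longrightarrow> oeval p (PRec f g) (0 # ns) r"
| PRec_Suc: "oeval p (PRec f g) (n # ns) m \<Longrightarrow> oeval p g (n # m # ns) r
    \<Longrightarrow> oeval p (PRec f g) (Suc n # ns) r"
| Mu: "oeval p f (n # ns) 0 \<Longrightarrow> (\<And>k. k < n \<Longrightarrow> \<exists>m. oeval p f (k # ns) (Suc m))
    \<Longrightarrow> oeval p (Mu f) ns n"

inductive_cases oeval_ZeroE: "oeval p Zero ns r"
inductive_cases oeval_SuccE: "oeval p Succ (n # ns) r"
inductive_cases oeval_ProjE: "oeval p (Proj i) ns r"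
inductive_cases oeval_QueryE: "oeval p Query (n # ns) r"
inductive_cases oeval_CompE: "oeval p (Comp f gs) ns r"
inductive_cases oeval_PRec_0E: "oeval p (PRec f g) (0 # ns) r"
inductive_cases oeval_PRec_SucE: "oeval p (PRec f g) (Suc n # ns) r"
inductive_cases oeval_MuE: "oeval p (Mu f) ns r"

lemma oeval_deterministic:
  "oeval p e ns r \<Longrightarrow> oeval p e ns r' \<Longrightarrow> r = r'"
proof (induction arbitrary: r' rule: oeval.induct)
  case (Comp ns gs ms f r)
  from Comp.prems obtain ms' where ms': "list_all2 (\<lambda>g m. oeval p g ns m) gs ms'" "oeval p f ms' r'"
    by (rule oeval_CompE)
  have "ms = ms'"
    using Comp.IH(1) ms'(1) unfolding list_all2_conv_all_nth by (metis nth_equalityI)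
  with ms'(2) have "oeval p f ms r'" by simp
  then show ?case by (rule Comp.IH(2))
next
  case (Mu f n ns)
  have r': "oeval p f (r' # ns) 0" using Mu.prems by (rule oeval_MuE)
  have r'': "\<exists>m. oeval p f (k # ns) (Suc m)" if "k < r'" for k
    using Mu.prems that by (elim oeval_MuE) simp
  show ?case
  proof (cases n r' rule: linorder_cases)
    case less
    from r''[OF this] obtain m where "oeval p f (n # ns) (Suc m)" ..
    from Mu.IH(1)[OF this] show ?thesis by simp
  next
    case greater
    from Mu.IH(2)[OF this] r' show ?thesis by blast
  qed
next
  case (PRec_0 f ns r g)
  from PRec_0.prems have "oeval p f ns r'" by (rule oeval_PRec_0E)
  then show ?case by (rule PRec_0.IH)
next
  case (PRec_Suc f g n ns m r)
  from PRec_Suc.prems obtain m' where m': "oeval p (PRec f g) (n # ns) m'" "oeval p g (n # m' # ns) r'"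
    by (rule oeval_PRec_SucE)
  from m'(1) have "m = m'" by (rule PRec_Suc.IH)
  with m'(2) have "oeval p g (n # m # ns) r'" by simp
  then show ?case by (rule PRec_Suc.IH)
next
  case (Zero ns)
  then show ?case by (auto elim: oeval_ZeroE)
next
  case (Succ n ns)
  then show ?case by (auto elim: oeval_SuccE)
next
  case (Proj i ns)
  then show ?case by (auto elim: oeval_ProjE)
next
  case (Query n ns)
  then show ?case by (auto elim: oeval_QueryE)
qed


section \<open>Computable functionals\<close>

text \<open>
  Points of a space are presented to a program by names in Baire space. All name functions
  below are injective, so a functional on points is the same as a functional on names.
\<close>

type_synonym 'a naming = "'a \<Rightarrow> nat \<Rightarrow> nat"

type_synonym cantor = "nat \<Rightarrow> bool"

definition cantor_name :: "cantor naming" where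
  "cantor_name x k = of_bool (x k)"

definition bit_name :: "bit naming" where
  "bit_name b k = (if k = 0 then of_bit b else 0)"

definition pair_name :: "'a naming \<Rightarrow> 'b naming \<Rightarrow> ('a \<times> 'b) naming" where
  "pair_name N M z k = (if even k then N (fst z) (k div 2) else M (snd z) (k div 2))"

definition list_name :: "'a naming \<Rightarrow> 'a list naming" where
  "list_name N xs k = (case k of
      0 \<Rightarrow> length xs
    | Suc l \<Rightarrow> (case prod_decode l of (i, j) \<Rightarrow> if i < length xs then N (xs ! i) j else 0))"

lemma inj_cantor_name: "inj cantor_name"
  by (auto simp: inj_def cantor_name_def fun_eq_iff)

lemma inj_bit_name: "inj bit_name"
proof (rule injI)
  fix b c assume "bit_name b = bit_name c"
  from fun_cong[OF this, of 0] show "b = c"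
    by (cases b; cases c) (simp_all add: bit_name_def)
qed

lemma inj_pair_name:
  assumes "inj N" "inj M"
  shows "inj (pair_name N M)"
proof (rule injI)
  fix z z' assume eq: "pair_name N M z = pair_name N M z'"
  have "N (fst z) k = N (fst z') k" "M (snd z) k = M (snd z') k" for k
    using fun_cong[OF eq, of "2 * k"] fun_cong[OF eq, of "2 * k + 1"] by (simp_all add: pair_name_def)
  then show "z = z'"
    using assms by (metis ext injD prod_eqI)
qed

lemma inj_list_name:
  assumes "inj N"
  shows "inj (list_name N)"
proof (rule injI)
  fix xs ys assume eq: "list_name N xs = list_name N ys"
  have len: "length xs = length ys"
    using fun_cong[OF eq, of 0] by (simp add: list_name_def)
  have "N (xs ! i) j = N (ys ! i) j" if "i < length xs" for i j
    using fun_cong[OF eq, of "Suc (prod_encode (i, j))"] that len by (simp add: list_name_def)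
  then show "xs = ys"
    using assms len by (metis ext injD nth_equalityI)
qed

definition computable :: "'a naming \<Rightarrow> 'b naming \<Rightarrow> ('a \<rightharpoonup> 'b) \<Rightarrow> bool" where
  "computable N M F \<longleftrightarrow>
     (\<exists>e. \<forall>x y. F x = Some y \<longrightarrow> (\<forall>k. oeval (N x) e [k] (M y k)))"


section \<open>Weihrauch reducibility\<close>

text \<open>
  For \<open>f :\<subseteq> A \<rightarrow> B\<close> and \<open>g :\<subseteq> C \<rightarrow> D\<close>, with names for the points of
  \<open>A\<close>, \<open>B\<close>, \<open>C\<close>, \<open>D\<close> given in this order.
\<close>

definition weihrauch_le ::
  "'a naming \<Rightarrow> 'b naming \<Rightarrow> 'c naming \<Rightarrow> 'd naming \<Rightarrow> ('a \<rightharpoonup> 'b) \<Rightarrow> ('c \<rightharpoonup> 'd) \<Rightarrow> bool" where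
  "weihrauch_le A B C D f g \<longleftrightarrow>
     (\<exists>\<Phi> \<Psi>. computable A C \<Phi> \<and> computable (pair_name A D) B \<Psi> \<and>
        (\<forall>x \<in> dom f. \<exists>z w. \<Phi> x = Some z \<and> g z = Some w \<and> f x = \<Psi> (x, w)))"


section \<open>The functions under consideration\<close>

definition proper :: "cantor \<Rightarrow> bool" where
  "proper \<alpha> \<longleftrightarrow> infinite {k. \<alpha> k}"

definition step :: "cantor \<Rightarrow> cantor \<Rightarrow> bit" where
  "step \<alpha> x = (if less_fun x \<alpha> then 0 else 1)"

text \<open>Elements of \<open>X\<^sup>m\<close> are lists of length \<open>m\<close>.\<close>

definition step_xor :: "cantor list \<Rightarrow> cantor list \<rightharpoonup> bit" where
  "step_xor \<alpha>s xs =
     (if length xs = length \<alpha>s then Some (\<Sum>i<length \<alpha>s. step (\<alpha>s ! i) (xs ! i)) else None)"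

definition product :: "('a \<Rightarrow> 'b) list \<Rightarrow> 'a list \<rightharpoonup> 'b list" where
  "product fs xs =
     (if length xs = length fs then Some (map2 (\<lambda>f x. f x) fs xs) else None)"

end

(* Let the inputs start at (alpha_1, ..., alpha_{n+1}) and push them, one coordinate at a time,
   slightly below the jumps. Each push flips the parity. A bit 0 of an answer of the oracle
   s_{alpha'_1} x ... x s_{alpha'_n} persists under small changes of its input, and an unchanged
   answer would force an unchanged parity by continuity; so each push turns at least one of the
   n answer bits from 1 to 0, which cannot happen n+1 times. *)

theory Submission
  imports Defs "HOL-Library.Infinite_Set"
begin

section \<open>Continuity of computable functionals and of list names\<close>

text \<open>A halting computation queries its oracle only finitely often, so any oracle that agrees
  far enough yields the same run. Where a run has several subcomputations, the sum of their bounds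
  serves as a common bound.\<close>

lemma oeval_finite_use:
  assumes "oeval p e ns r"
  shows "\<exists>K. \<forall>q. (\<forall>i<K. q i = p i) \<longrightarrow> oeval q e ns r"
  using assms
proof (induction rule: oeval.induct)
  case (Query n ns)
  have "oeval q oprog.Query (n # ns) (p n)" if "\<forall>i<Suc n. q i = p i" for q
    using oeval.Query[of q n ns] that by simp
  then show ?case by blast
next
  case (Comp ns gs ms f r)
  have len: "length gs = length ms" using Comp.IH(1) by (rule list_all2_lengthD)
  have "\<forall>i<length gs. \<exists>K. \<forall>q. (\<forall>i<K. q i = p i) \<longrightarrow> oeval q (gs ! i) ns (ms ! i)"
    using Comp.IH(1) by (simp add: list_all2_conv_all_nth)
  then obtain K where K: "\<And>i q. i < length gs \<Longrightarrow> \<forall>j<K i. q j = p j \<Longrightarrow> oeval q (gs ! i) ns (ms ! i)"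
    by metis
  obtain L where L: "\<And>q. \<forall>i<L. q i = p i \<Longrightarrow> oeval q f ms r"
    using Comp.IH(2) by blast
  have "oeval q (oprog.Comp f gs) ns r" if "\<forall>i < L + (\<Sum>i<length gs. K i). q i = p i" for q
  proof (rule oeval.Comp)
    have "K i \<le> L + (\<Sum>i<length gs. K i)" if "i < length gs" for i
      using member_le_sum[of i "{..<length gs}" K] that by simp
    then have "oeval q (gs ! i) ns (ms ! i)" if "i < length gs" for i
      using K[OF that] \<open>\<forall>i < L + _. q i = p i\<close> that by (meson less_le_trans)
    then show "list_all2 (\<lambda>g m. oeval q g ns m) gs ms"
      using len by (simp add: list_all2_conv_all_nth)
    show "oeval q f ms r" using that by (intro L) simp
  qed
  then show ?case by blast
next
  case (PRec_0 f ns r g)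
  then show ?case by (blast intro: oeval.PRec_0)
next
  case (PRec_Suc f g n ns m r)
  then obtain K L where KL: "\<And>q. \<forall>i<K. q i = p i \<Longrightarrow> oeval q (PRec f g) (n # ns) m"
      "\<And>q. \<forall>i<L. q i = p i \<Longrightarrow> oeval q g (n # m # ns) r"
    by blast
  have "oeval q (PRec f g) (Suc n # ns) r" if "\<forall>i<K + L. q i = p i" for q
    using that by (intro oeval.PRec_Suc[of q f g n ns m] KL) simp_all
  then show ?case by blast
next
  case (Mu f n ns)
  obtain L where L: "\<And>q. \<forall>i<L. q i = p i \<Longrightarrow> oeval q f (n # ns) 0"
    using Mu.IH(1) by blast
  \<comment> \<open>The nonzero value \<open>Suc m\<close> is fixed before \<open>q\<close>, so one
    bound per \<open>k\<close> serves all nearby oracles, and only finitely many \<open>k\<close>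
    occur.\<close>
  have "\<forall>k<n. \<exists>K m. \<forall>q. (\<forall>i<K. q i = p i) \<longrightarrow> oeval q f (k # ns) (Suc m)"
    using Mu.IH(2) by blast
  then obtain K m where K: "\<And>k q. k < n \<Longrightarrow> \<forall>i<K k. q i = p i \<Longrightarrow> oeval q f (k # ns) (Suc (m k))"
    by metis
  have "oeval q (oprog.Mu f) ns n" if q: "\<forall>i < L + (\<Sum>k<n. K k). q i = p i" for q
  proof (rule oeval.Mu)
    show "oeval q f (n # ns) 0" using q by (intro L) simp
    fix k assume k: "k < n"
    then have "K k \<le> L + (\<Sum>k<n. K k)"
      using member_le_sum[of k "{..<n}" K] by simp
    with q have "oeval q f (k # ns) (Suc (m k))" by (intro K k) simp
    then show "\<exists>m. oeval q f (k # ns) (Suc m)" ..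
  qed
  then show ?case by blast
qed (blast intro: oeval.intros)+

text \<open>The digit \<open>k\<close> of the output name is produced by a halting run that sees a
  finite prefix of the input name; on a nearby point of the domain the same run occurs, and
  determinism forces the same digit.\<close>

lemma computable_continuous:
  assumes "computable N M F" "F x = Some y"
  obtains K where "\<And>x' y'. \<forall>i<K. N x' i = N x i \<Longrightarrow> F x' = Some y' \<Longrightarrow> M y' k = M y k"
proof -
  obtain e where e: "\<And>x y k. F x = Some y \<Longrightarrow> oeval (N x) e [k] (M y k)"
    using assms(1) unfolding computable_def by blast
  obtain K where "\<And>q. \<forall>i<K. q i = N x i \<Longrightarrow> oeval q e [k] (M y k)"
    using oeval_finite_use[OF e[OF assms(2)]] by blast
  then show ?thesis
    by (intro that[of K]) (metis e oeval_deterministic)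
qed

lemma computable_continuous_upto:
  assumes "computable N M F" "F x = Some y"
  obtains K where
    "\<And>x' y'. \<forall>i<K. N x' i = N x i \<Longrightarrow> F x' = Some y' \<Longrightarrow> \<forall>k<l. M y' k = M y k"
proof -
  have "\<exists>K. \<forall>x' y'. (\<forall>i<K. N x' i = N x i) \<longrightarrow> F x' = Some y' \<longrightarrow> M y' k = M y k" for k
    by (rule computable_continuous[OF assms]) blast
  then obtain K where K: "\<And>k x' y'. \<forall>i<K k. N x' i = N x i \<Longrightarrow> F x' = Some y' \<Longrightarrow> M y' k = M y k"
    by metis
  have "K k \<le> (\<Sum>k<l. K k)" if "k < l" for k
    using member_le_sum[of k "{..<l}" K] that by simp
  then show ?thesis
    by (intro that[of "\<Sum>k<l. K k"]) (meson K less_le_trans)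
qed

text \<open>Position \<open>Suc l\<close> of a list name holds digit \<open>j\<close> of entry
  \<open>i\<close>, where \<open>l\<close> codes \<open>(i, j)\<close> and hence
  \<open>j \<le> l\<close>. A prefix of length \<open>K\<close> therefore reads only digits below
  \<open>K\<close> of the entries.\<close>

lemma list_name_cong:
  assumes "length xs = length ys"
    and "\<And>i j. i < length ys \<Longrightarrow> j < K \<Longrightarrow> N (xs ! i) j = N (ys ! i) j"
  shows "\<forall>k<K. list_name N xs k = list_name N ys k"
proof (intro allI impI)
  fix k assume k: "k < K"
  show "list_name N xs k = list_name N ys k"
  proof (cases k)
    case (Suc l)
    obtain i j where ij: "prod_decode l = (i, j)" by fastforce
    then have "j \<le> l" using le_prod_encode_2[of j i] by (metis prod_decode_inverse)
    with ij k Suc show ?thesis using assms by (simp add: list_name_def)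
  qed (simp add: list_name_def assms)
qed

lemma list_name_nth:
  "i < length xs \<Longrightarrow> list_name N xs (Suc (prod_encode (i, j))) = N (xs ! i) j"
  by (simp add: list_name_def)

section \<open>Step functions near their jumps\<close>

lemma step_self [simp]: "step a a = 1"
  by (auto simp: step_def less_fun_def)

text \<open>Properness supplies a 1 of \<open>a\<close> beyond any prefix; turning it into 0 gives a
  point strictly below \<open>a\<close> with the same prefix.\<close>

lemma proper_approx_below:
  assumes "proper a"
  obtains x where "step a x = 0" "\<forall>k<K. x k = a k"
proof -
  obtain k where k: "k \<ge> K" "a k"
    using assms unfolding proper_def infinite_nat_iff_unbounded_le by blast
  show ?thesis
  proof (rule that)
    have "less_fun (a(k := False)) a"
      using k unfolding less_fun_def by (intro exI[of _ k]) auto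
    then show "step a (a(k := False)) = 0" by (simp add: step_def)
  qed (use k in simp)
qed

text \<open>Lying strictly below \<open>a\<close> is an open condition: it is witnessed at the first
  position of difference.\<close>

lemma step_eq_0_persists:
  assumes "step a x = 0"
  obtains K where "\<And>x'. \<forall>k<K. x' k = x k \<Longrightarrow> step a x' = 0"
proof -
  obtain k where k: "x k < a k" "\<And>j. j < k \<Longrightarrow> x j = a j"
    using assms unfolding step_def less_fun_def by (auto split: if_splits)
  have "step a x' = 0" if "\<forall>j<Suc k. x' j = x j" for x'
  proof -
    have "less_fun x' a"
      unfolding less_fun_def using k that by (intro exI[of _ k]) auto
    then show ?thesis by (simp add: step_def)
  qed
  then show ?thesis by (rule that)
qed

text \<open>Each answer bit 0 is secured by finitely many digits of one component of the query
  \<open>z\<close>, hence by a finite prefix of the name of \<open>z\<close>, which by continuity of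
  \<open>\<Phi>\<close> is secured by a finite prefix of the name of \<open>x\<close>.\<close>

lemma product_step_0_persists:
  assumes "computable N (list_name cantor_name) \<Phi>"
    and "\<Phi> x = Some z" "product (map step \<alpha>) z = Some w"
  obtains K where "\<And>x' z' w'. \<forall>i<K. N x' i = N x i \<Longrightarrow> \<Phi> x' = Some z'
    \<Longrightarrow> product (map step \<alpha>) z' = Some w' \<Longrightarrow> \<forall>j<length \<alpha>. w ! j = 0 \<longrightarrow> w' ! j = 0"
proof -
  have prod: "length z = length \<alpha>" "\<And>j. j < length \<alpha> \<Longrightarrow> w ! j = step (\<alpha> ! j) (z ! j)"
    if "product (map step \<alpha>) z = Some w" for z w
    using that by (auto simp: product_def split: if_splits)
  have "\<exists>L. \<forall>y. w ! j = 0 \<longrightarrow> j < length \<alpha> \<longrightarrow> (\<forall>k<L. y k = (z ! j) k) \<longrightarrow> step (\<alpha> ! j) y = 0" for j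
    using prod(2)[OF assms(3)] by (metis step_eq_0_persists)
  then obtain L where L: "\<And>j y. w ! j = 0 \<Longrightarrow> j < length \<alpha> \<Longrightarrow> \<forall>k<L j. y k = (z ! j) k
      \<Longrightarrow> step (\<alpha> ! j) y = 0"
    by metis
  \<comment> \<open>A sum in place of a maximum: \<open>l\<close> exceeds every position in the name
    of \<open>z\<close> that holds a digit \<open>k < L j\<close> of a component
    \<open>j\<close>.\<close>
  define l where "l = Suc (\<Sum>j<length \<alpha>. \<Sum>k<L j. Suc (prod_encode (j, k)))"
  have l: "Suc (prod_encode (j, k)) < l" if "j < length \<alpha>" "k < L j" for j k
  proof -
    have "Suc (prod_encode (j, k)) \<le> (\<Sum>k<L j. Suc (prod_encode (j, k)))"
      using that by (intro member_le_sum) auto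
    also have "\<dots> \<le> (\<Sum>j<length \<alpha>. \<Sum>k<L j. Suc (prod_encode (j, k)))"
      using that by (intro member_le_sum[of j _ "\<lambda>j. \<Sum>k<L j. Suc (prod_encode (j, k))"]) auto
    finally show ?thesis by (simp add: l_def)
  qed
  obtain K where K: "\<And>x' z'. \<forall>i<K. N x' i = N x i \<Longrightarrow> \<Phi> x' = Some z'
      \<Longrightarrow> \<forall>k<l. list_name cantor_name z' k = list_name cantor_name z k"
    using computable_continuous_upto[OF assms(1,2)] by blast
  show ?thesis
  proof (rule that[of K], intro allI impI)
    fix x' z' w' j
    assume x': "\<forall>i<K. N x' i = N x i" "\<Phi> x' = Some z'" "product (map step \<alpha>) z' = Some w'"
      and j: "j < length \<alpha>" "w ! j = 0"
    have "(z' ! j) k = (z ! j) k" if k: "k < L j" for k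
    proof -
      have "list_name cantor_name z' (Suc (prod_encode (j, k)))
          = list_name cantor_name z (Suc (prod_encode (j, k)))"
        using K[OF x'(1,2)] l[OF j(1) k] by blast
      then show ?thesis
        using j(1) prod(1)[OF assms(3)] prod(1)[OF x'(3)]
        by (simp add: list_name_nth cantor_name_def of_bool_eq_iff)
    qed
    then show "w' ! j = 0" using L[OF j(2,1)] prod(2)[OF x'(3) j(1)] by simp
  qed
qed

text \<open>The remaining sum does not depend on \<open>y\<close>, so two values of coordinate
  \<open>k\<close> can be compared by their steps alone.\<close>

lemma step_xor_update:
  assumes "length xs = length \<alpha>" "k < length \<alpha>"
  shows "step_xor \<alpha> (xs[k := y])
    = Some (step (\<alpha> ! k) y + (\<Sum>i\<in>{..<length \<alpha>} - {k}. step (\<alpha> ! i) (xs ! i)))"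
  using assms by (simp add: step_xor_def sum.remove[of _ k])

theorem mainTheorem3:
  fixes n :: nat and \<alpha> \<alpha>' :: "cantor list"
  assumes "n > 0"
    and "length \<alpha> = n + 1" and "\<forall>a \<in> set \<alpha>. proper a"
    and "length \<alpha>' = n" and "\<forall>a \<in> set \<alpha>'. proper a"
  shows "\<not> weihrauch_le
            (list_name cantor_name) bit_name (list_name cantor_name) (list_name bit_name)
            (step_xor \<alpha>) (product (map step \<alpha>'))"
proof
  let ?A = "list_name cantor_name" and ?D = "list_name bit_name"
  let ?g = "product (map step \<alpha>')"
  assume "weihrauch_le ?A bit_name ?A ?D (step_xor \<alpha>) ?g"
  then obtain \<Phi> \<Psi> where \<Phi>: "computable ?A ?A \<Phi>"
    and \<Psi>: "computable (pair_name ?A ?D) bit_name \<Psi>"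
    and red: "\<And>x. x \<in> dom (step_xor \<alpha>)
      \<Longrightarrow> \<exists>z w. \<Phi> x = Some z \<and> ?g z = Some w \<and> step_xor \<alpha> x = \<Psi> (x, w)"
    unfolding weihrauch_le_def by blast
  have red: "\<exists>z w. \<Phi> x = Some z \<and> ?g z = Some w \<and> step_xor \<alpha> x = \<Psi> (x, w)"
    if "length x = n + 1" for x
    using that assms(2) by (intro red) (simp add: dom_def step_xor_def)
  \<comment> \<open>State after \<open>k\<close> pushes: the coordinates from \<open>k\<close> on
    still sit at their jumps, and at most \<open>n - k\<close> answer bits are 1. For
    \<open>k = n + 1\<close> the inequality is absurd.\<close>
  have "\<exists>x z w. length x = n + 1 \<and> (\<forall>i. k \<le> i \<longrightarrow> i < n + 1 \<longrightarrow> x ! i = \<alpha> ! i)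
      \<and> \<Phi> x = Some z \<and> ?g z = Some w \<and> k + card {j. j < n \<and> w ! j = 1} \<le> n"
    if "k \<le> n + 1" for k
    using that
  proof (induction k)
    case 0
    obtain z w where "\<Phi> \<alpha> = Some z" "?g z = Some w" using red assms(2) by metis
    moreover have "card {j. j < n \<and> w ! j = 1} \<le> card {..<n}"
      by (intro card_mono) auto
    ultimately show ?case using assms(2) by (intro exI[of _ \<alpha>] exI[of _ z] exI[of _ w]) auto
  next
    case (Suc k)
    from Suc.IH[OF Suc_leD[OF Suc.prems]] obtain x z w where x: "length x = n + 1" "\<And>i. k \<le> i \<Longrightarrow> i < n + 1 \<Longrightarrow> x ! i = \<alpha> ! i"
      and zw: "\<Phi> x = Some z" "?g z = Some w" and card: "k + card {j. j < n \<and> w ! j = 1} \<le> n"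
      by blast
    have k: "k < n + 1" using Suc.prems by simp
    obtain b where b: "step_xor \<alpha> x = Some b" using x(1) assms(2) by (simp add: step_xor_def)
    have \<Psi>b: "\<Psi> (x, w) = Some b" using red[OF x(1)] zw b by auto
    \<comment> \<open>Two moduli at the current input: within \<open>K\<close> the zero bits of
      \<open>w\<close> survive; within \<open>L\<close> the digit 0 of the output name of
      \<open>\<Psi>\<close>, which is the output bit itself, cannot change.\<close>
    obtain K where K: "\<And>x' z' w'. \<forall>i<K. ?A x' i = ?A x i \<Longrightarrow> \<Phi> x' = Some z'
        \<Longrightarrow> ?g z' = Some w' \<Longrightarrow> \<forall>j<n. w ! j = 0 \<longrightarrow> w' ! j = 0"
      using product_step_0_persists[OF \<Phi> zw] assms(4) by blast
    obtain L where L: "\<And>v b'. \<forall>i<L. pair_name ?A ?D v i = pair_name ?A ?D (x, w) i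
        \<Longrightarrow> \<Psi> v = Some b' \<Longrightarrow> bit_name b' 0 = bit_name b 0"
      using computable_continuous[OF \<Psi> \<Psi>b] by blast
    have "proper (\<alpha> ! k)" using assms(2,3) k by simp
    \<comment> \<open>Agreement up to \<open>K + L\<close> makes both moduli apply to the pushed
      input.\<close>
    then obtain y where y: "step (\<alpha> ! k) y = 0" "\<forall>i<K + L. y i = (\<alpha> ! k) i"
      by (rule proper_approx_below)
    define x' where "x' = x[k := y]"
    have x': "length x' = n + 1" using x(1) by (simp add: x'_def)
    obtain z' w' where zw': "\<Phi> x' = Some z'" "?g z' = Some w'" "step_xor \<alpha> x' = \<Psi> (x', w')"
      using red[OF x'] by blast
    have near: "\<forall>i<K + L. ?A x' i = ?A x i"
      using x(1) x(2)[of k] y(2) k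
      by (intro list_name_cong) (auto simp: x'_def nth_list_update cantor_name_def)
    \<comment> \<open>Reading \<open>x\<close> as an update of itself lets
      \<open>step_xor_update\<close> describe both inputs; summand \<open>k\<close> drops from 1 to
      0, so the parity becomes \<open>b + 1\<close>.\<close>
    have "x[k := \<alpha> ! k] = x" using x k by (simp add: list_update_same_conv)
    then have xor': "step_xor \<alpha> x' = Some (b + 1)"
      using step_xor_update[of x \<alpha> k y] step_xor_update[of x \<alpha> k "\<alpha> ! k"]
        x(1) k b y(1) assms(2)
      by (cases "\<Sum>i\<in>{..<length \<alpha>} - {k}. step (\<alpha> ! i) (x ! i)")
        (simp_all add: x'_def)
    \<comment> \<open>With an equal answer, \<open>\<Psi>\<close> would receive two inputs that
      agree up to \<open>L\<close> and yet return different bits.\<close>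
    have "w' \<noteq> w"
    proof
      assume "w' = w"
      moreover have "\<forall>i<L. pair_name ?A ?D (x', w) i = pair_name ?A ?D (x, w) i"
        using near by (auto simp: pair_name_def)
      ultimately have "bit_name (b + 1) 0 = bit_name b 0"
        using L zw'(3) xor' by auto
      then show False by (cases b) (simp_all add: bit_name_def)
    qed
    moreover have le: "\<forall>j<n. w ! j = 0 \<longrightarrow> w' ! j = 0"
      using K[of x'] near zw' by simp
    moreover have "length w = n" "length w' = n"
      using zw(2) zw'(2) assms(4) by (auto simp: product_def split: if_splits)
    ultimately obtain j where j: "j < n" "w ! j \<noteq> w' ! j"
      by (metis nth_equalityI)
    with le have "w ! j = 1" "w' ! j = 0"
      by (metis bit.exhaust)+
    moreover have "w ! i = 1" if "i < n" "w' ! i = 1" for i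
      using le that by (cases "w ! i") auto
    \<comment> \<open>No bit rises from 0 to 1, and bit \<open>j\<close> falls, so the set of 1 bits
      shrinks strictly.\<close>
    ultimately have "{j. j < n \<and> w' ! j = 1} \<subset> {j. j < n \<and> w ! j = 1}"
      using j(1) by (intro psubsetI) (auto simp: set_eq_iff intro!: exI[of _ j])
    then have "card {j. j < n \<and> w' ! j = 1} < card {j. j < n \<and> w ! j = 1}"
      by (intro psubset_card_mono) auto
    with card have "Suc k + card {j. j < n \<and> w' ! j = 1} \<le> n" by simp
    moreover have "\<forall>i. Suc k \<le> i \<longrightarrow> i < n + 1 \<longrightarrow> x' ! i = \<alpha> ! i"
      using x by (simp add: x'_def)
    ultimately show ?case using x' zw'(1,2) by blast
  qed
  from this[of "n + 1"] show False by auto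
qed

end
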